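(* Let $\alpha,\beta,\gamma,\delta:\mathbb{R}^2\to\mathbb{R}$ and let $\psi(x,t)=\mathrm{e}^{\alpha(x,t)+\beta(x,t)\mathbf{i_1}+\gamma(x,t)\mathbf{i_2}+\delta(x,t)\mathbf{j}}\in\mathbb{T}$. Then the bicomplex Born formulas are preserved under all the discrete symmetries $\hat P_0,\dots,\hat P_7$, i.e. $$|\hat P_n\psi(x,t)|_{\mathbf{k}}^2=|\psi(x,t)|_{\mathbf{k}}^2\quad\text{for all } n\in\{0,\dots,7\},\ \mathbf{k}\in\{1,2,3\},\ (x,t)\in\mathbb{R}^2,$$ if and only if $\psi(x,t)=\mathrm{e}^{\alpha(x,t)+\beta(x,t)\mathbf{i_1}+\gamma(x,t)\mathbf{i_2}}$, i.e. if and only if $\delta(x,t)=0$ for all $(x,t)$.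
   Context: The bicomplex numbers are the commutative ring $\mathbb{T}=\{w_0+w_1\mathbf{i_1}+w_2\mathbf{i_2}+w_3\mathbf{j}: w_0,\dots,w_3\in\mathbb{R}\}$ with $\mathbf{i_1}^2=\mathbf{i_2}^2=-1$, $\mathbf{j}^2=1$, $\mathbf{i_1}\mathbf{i_2}=\mathbf{i_2}\mathbf{i_1}=\mathbf{j}$, $\mathbf{i_1}\mathbf{j}=\mathbf{j}\mathbf{i_1}=-\mathbf{i_2}$, $\mathbf{i_2}\mathbf{j}=\mathbf{j}\mathbf{i_2}=-\mathbf{i_1}$. For $k=1,2$, $\mathbb{C}(\mathbf{i_k})=\{x+y\mathbf{i_k}:x,y\in\mathbb{R}\}$ is a copy of the complex numbers with its usual modulus. The exponential is the usual power series. Real moduli: every $w\in\mathbb{T}$ can be written uniquely as $w=z_1+z_2\mathbf{i_2}$ with $z_1,z_2\in\mathbb{C}(\mathbf{i_1})$, and uniquely as $w=u_1+u_2\mathbf{i_1}$ with $u_1,u_2\in\mathbb{C}(\mathbf{i_2})$. Then $|w|_{\mathbf{1}}=|z_1^2+z_2^2|^{1/2}$, $|w|_{\mathbf{2}}=|u_1^2+u_2^2|^{1/2}$, and $|w|_{\mathbf{3}}=\sqrt{|z_1|^2+|z_2|^2}$ (the Euclidean norm on $\mathbb{R}^4$). Discrete symmetries: $\hat P_n\psi$ is obtained from $\mathrm{e}^{\alpha+\beta\mathbf{i_1}+\gamma\mathbf{i_2}+\delta\mathbf{j}}$ by keeping $\alpha,\beta$ and replacing $(\gamma,\delta)$ by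 (products in $\mathbb{T}$): $n=0$: $(\gamma,\delta)$; $n=1$: $(-\gamma,-\delta)$; $n=2$: $(-\delta\mathbf{i_2},\gamma\mathbf{i_2})$; $n=3$: $(\delta\mathbf{i_2},-\gamma\mathbf{i_2})$; $n=4$: $(\delta\mathbf{i_1},-\gamma\mathbf{i_1})$; $n=5$: $(-\delta\mathbf{i_1},\gamma\mathbf{i_1})$; $n=6$: $(\gamma\mathbf{j},\delta\mathbf{j})$; $n=7$: $(-\gamma\mathbf{j},-\delta\mathbf{j})$. *)

theory Defs
  imports "HOL-Analysis.Analysis"
begin

text \<open>\<open>Bicomplex a b c d\<close> stands for a + b i1 + c i2 + d j.\<close>

datatype bicomplex = Bicomplex (bc0: real) (bc1: real) (bc2: real) (bc3: real)

lemma bicomplex_eq_iff: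
  "v = w \<longleftrightarrow> bc0 v = bc0 w \<and> bc1 v = bc1 w \<and> bc2 v = bc2 w \<and> bc3 v = bc3 w"
  by (cases v; cases w) simp

text \<open>The product is the bilinear extension of the multiplication table of the units; the
  table itself is proved below (\<open>bc_unit_mult\<close>). The real vector space is four-dimensional, so
  every norm gives the same topology and hence the same exponential series. The class of normed
  algebras requires a submultiplicative norm, which the Euclidean norm (\<open>bc_mod3\<close> below) is not;
  the instance therefore uses the sum of the absolute values of the coordinates.\<close>

instantiation bicomplex :: "{comm_ring_1, real_algebra_1}"
begin

definition "0 = Bicomplex 0 0 0 0"
definition "1 = Bicomplex 1 0 0 0"
definition "v + w = Bicomplex (bc0 v + bc0 w) (bc1 v + bc1 w) (bc2 v + bc2 w) (bc3 v + bc3 w)"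
definition "v - w = Bicomplex (bc0 v - bc0 w) (bc1 v - bc1 w) (bc2 v - bc2 w) (bc3 v - bc3 w)"
definition "- w = Bicomplex (- bc0 w) (- bc1 w) (- bc2 w) (- bc3 w)"
definition "r *\<^sub>R w = Bicomplex (r * bc0 w) (r * bc1 w) (r * bc2 w) (r * bc3 w)"
definition "v * w = Bicomplex
    (bc0 v * bc0 w - bc1 v * bc1 w - bc2 v * bc2 w + bc3 v * bc3 w)
    (bc0 v * bc1 w + bc1 v * bc0 w - bc2 v * bc3 w - bc3 v * bc2 w)
    (bc0 v * bc2 w + bc2 v * bc0 w - bc1 v * bc3 w - bc3 v * bc1 w)
    (bc0 v * bc3 w + bc3 v * bc0 w + bc1 v * bc2 w + bc2 v * bc1 w)"

lemmas bc_ring_defs = zero_bicomplex_def one_bicomplex_def plus_bicomplex_def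
  minus_bicomplex_def uminus_bicomplex_def scaleR_bicomplex_def times_bicomplex_def

instance
  by standard (simp_all add: bc_ring_defs algebra_simps)

end

instantiation bicomplex :: real_normed_algebra_1
begin

definition norm_bicomplex_def:
  "norm w = \<bar>bc0 w\<bar> + \<bar>bc1 w\<bar> + \<bar>bc2 w\<bar> + \<bar>bc3 w\<bar>"
definition sgn_bicomplex_def: "sgn (w :: bicomplex) = w /\<^sub>R norm w"
definition dist_bicomplex_def: "dist (v :: bicomplex) w = norm (v - w)"
definition uniformity_bicomplex_def:
  "(uniformity :: (bicomplex \<times> bicomplex) filter) = (INF e\<in>{0 <..}. principal {(v, w). dist v w < e})"
definition open_bicomplex_def:
  "open (U :: bicomplex set) \<longleftrightarrow> (\<forall>v\<in>U. eventually (\<lambda>(v', w). v' = v \<longrightarrow> w \<in> U) uniformity)"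

instance
proof
  fix v w :: bicomplex and r :: real and S :: "bicomplex set"
  show "dist v w = norm (v - w)" by (fact dist_bicomplex_def)
  show "sgn w = w /\<^sub>R norm w" by (fact sgn_bicomplex_def)
  show "uniformity = (INF e\<in>{0 <..}. principal {(v::bicomplex, w). dist v w < e})"
    by (fact uniformity_bicomplex_def)
  show "open S \<longleftrightarrow> (\<forall>v\<in>S. eventually (\<lambda>(v', w). v' = v \<longrightarrow> w \<in> S) uniformity)"
    by (fact open_bicomplex_def)
  show "norm w = 0 \<longleftrightarrow> w = 0"
    by (auto simp: norm_bicomplex_def bicomplex_eq_iff zero_bicomplex_def)
  show "norm (v + w) \<le> norm v + norm w"
    using abs_triangle_ineq [of "bc0 v" "bc0 w"] abs_triangle_ineq [of "bc1 v" "bc1 w"]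
      abs_triangle_ineq [of "bc2 v" "bc2 w"] abs_triangle_ineq [of "bc3 v" "bc3 w"]
    unfolding norm_bicomplex_def plus_bicomplex_def bicomplex.sel by argo
  show "norm (r *\<^sub>R w) = \<bar>r\<bar> * norm w"
    by (simp add: norm_bicomplex_def scaleR_bicomplex_def abs_mult algebra_simps)
  show "norm (1 :: bicomplex) = 1"
    by (simp add: norm_bicomplex_def one_bicomplex_def)
  have tri: "\<bar>a - b - c + d\<bar> \<le> \<bar>a\<bar> + \<bar>b\<bar> + \<bar>c\<bar> + \<bar>d\<bar>"
    "\<bar>a + b - c - d\<bar> \<le> \<bar>a\<bar> + \<bar>b\<bar> + \<bar>c\<bar> + \<bar>d\<bar>"
    "\<bar>a + b + c + d\<bar> \<le> \<bar>a\<bar> + \<bar>b\<bar> + \<bar>c\<bar> + \<bar>d\<bar>" for a b c d :: real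
    by linarith+
  have "norm (v * w) \<le>
     (\<bar>bc0 v * bc0 w\<bar> + \<bar>bc1 v * bc1 w\<bar> + \<bar>bc2 v * bc2 w\<bar> + \<bar>bc3 v * bc3 w\<bar>) +
     (\<bar>bc0 v * bc1 w\<bar> + \<bar>bc1 v * bc0 w\<bar> + \<bar>bc2 v * bc3 w\<bar> + \<bar>bc3 v * bc2 w\<bar>) +
     (\<bar>bc0 v * bc2 w\<bar> + \<bar>bc2 v * bc0 w\<bar> + \<bar>bc1 v * bc3 w\<bar> + \<bar>bc3 v * bc1 w\<bar>) +
     (\<bar>bc0 v * bc3 w\<bar> + \<bar>bc3 v * bc0 w\<bar> + \<bar>bc1 v * bc2 w\<bar> + \<bar>bc2 v * bc1 w\<bar>)"
    unfolding norm_bicomplex_def times_bicomplex_def bicomplex.sel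
    by (intro add_mono tri)
  also have "\<dots> = norm v * norm w"
    by (simp add: norm_bicomplex_def abs_mult algebra_simps)
  finally show "norm (v * w) \<le> norm v * norm w" .
qed

end

lemma bounded_linear_bc:
  "bounded_linear bc0" "bounded_linear bc1" "bounded_linear bc2" "bounded_linear bc3"
  by (rule bounded_linear_intro [where K = 1];
      simp add: plus_bicomplex_def scaleR_bicomplex_def norm_bicomplex_def)+

instance bicomplex :: banach
proof
  fix X :: "nat \<Rightarrow> bicomplex"
  assume X: "Cauchy X"
  define L where "L = Bicomplex (lim (\<lambda>n. bc0 (X n))) (lim (\<lambda>n. bc1 (X n)))
    (lim (\<lambda>n. bc2 (X n))) (lim (\<lambda>n. bc3 (X n)))"
  have c: "(\<lambda>n. bc0 (X n)) \<longlonglongrightarrow> bc0 L" "(\<lambda>n. bc1 (X n)) \<longlonglongrightarrow> bc1 L"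
    "(\<lambda>n. bc2 (X n)) \<longlonglongrightarrow> bc2 L" "(\<lambda>n. bc3 (X n)) \<longlonglongrightarrow> bc3 L"
    using bounded_linear_bc [THEN bounded_linear.Cauchy, OF X]
    by (simp_all add: L_def Cauchy_convergent_iff convergent_LIMSEQ_iff)
  have "(\<lambda>n. norm (X n - L)) \<longlonglongrightarrow> 0"
    unfolding norm_bicomplex_def minus_bicomplex_def bicomplex.sel
    using c [THEN LIM_zero, THEN tendsto_rabs_zero]
    by (intro tendsto_add_zero)
  then have "X \<longlonglongrightarrow> L"
    by (simp add: tendsto_norm_zero_iff LIM_zero_iff)
  then show "convergent X"
    by (rule convergentI)
qed

definition bc_i1 :: bicomplex where "bc_i1 = Bicomplex 0 1 0 0"
definition bc_i2 :: bicomplex where "bc_i2 = Bicomplex 0 0 1 0"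
definition bc_j :: bicomplex where "bc_j = Bicomplex 0 0 0 1"

lemma bc_unit_mult:
  "bc_i1 * bc_i1 = -1" "bc_i2 * bc_i2 = -1" "bc_j * bc_j = 1"
  "bc_i1 * bc_i2 = bc_j" "bc_i2 * bc_i1 = bc_j"
  "bc_i1 * bc_j = - bc_i2" "bc_j * bc_i1 = - bc_i2"
  "bc_i2 * bc_j = - bc_i1" "bc_j * bc_i2 = - bc_i1"
  by (simp_all add: bc_i1_def bc_i2_def bc_j_def bc_ring_defs)

lemma bicomplex_expand:
  "Bicomplex a b c d = of_real a + of_real b * bc_i1 + of_real c * bc_i2 + of_real d * bc_j"
  by (simp add: of_real_def bc_i1_def bc_i2_def bc_j_def bc_ring_defs)

text \<open>\<open>complex_i1\<close> and \<open>complex_i2\<close> identify the complex numbers with the subfields C(i1) and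
  C(i2).\<close>

definition complex_i1 :: "complex \<Rightarrow> bicomplex"
  where "complex_i1 z = of_real (Re z) + of_real (Im z) * bc_i1"

definition complex_i2 :: "complex \<Rightarrow> bicomplex"
  where "complex_i2 z = of_real (Re z) + of_real (Im z) * bc_i2"

definition bc_z1 :: "bicomplex \<Rightarrow> complex" where "bc_z1 w = Complex (bc0 w) (bc1 w)"
definition bc_z2 :: "bicomplex \<Rightarrow> complex" where "bc_z2 w = Complex (bc2 w) (bc3 w)"
definition bc_u1 :: "bicomplex \<Rightarrow> complex" where "bc_u1 w = Complex (bc0 w) (bc2 w)"
definition bc_u2 :: "bicomplex \<Rightarrow> complex" where "bc_u2 w = Complex (bc1 w) (bc3 w)"

lemma bc_z_decomp:
  "w = complex_i1 z1 + complex_i1 z2 * bc_i2 \<longleftrightarrow> z1 = bc_z1 w \<and> z2 = bc_z2 w"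
  by (auto simp: complex_i1_def bc_z1_def bc_z2_def bicomplex_eq_iff complex_eq_iff
      of_real_def bc_i1_def bc_i2_def bc_ring_defs)

lemma bc_u_decomp:
  "w = complex_i2 u1 + complex_i2 u2 * bc_i1 \<longleftrightarrow> u1 = bc_u1 w \<and> u2 = bc_u2 w"
  by (auto simp: complex_i2_def bc_u1_def bc_u2_def bicomplex_eq_iff complex_eq_iff
      of_real_def bc_i1_def bc_i2_def bc_ring_defs)

definition bc_mod1 :: "bicomplex \<Rightarrow> real"
  where "bc_mod1 w = sqrt (cmod ((bc_z1 w)\<^sup>2 + (bc_z2 w)\<^sup>2))"

definition bc_mod2 :: "bicomplex \<Rightarrow> real"
  where "bc_mod2 w = sqrt (cmod ((bc_u1 w)\<^sup>2 + (bc_u2 w)\<^sup>2))"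

definition bc_mod3 :: "bicomplex \<Rightarrow> real"
  where "bc_mod3 w = sqrt ((cmod (bc_z1 w))\<^sup>2 + (cmod (bc_z2 w))\<^sup>2)"

text \<open>Only meant for k = 1, 2, 3.\<close>

definition bc_mod :: "nat \<Rightarrow> bicomplex \<Rightarrow> real"
  where "bc_mod k = (if k = 1 then bc_mod1 else if k = 2 then bc_mod2 else bc_mod3)"

text \<open>\<open>sym_coeffs n c d\<close> is the pair of bicomplex numbers that replaces (c, d); only meant for
  n = 0, ..., 7.\<close>

definition sym_coeffs :: "nat \<Rightarrow> real \<Rightarrow> real \<Rightarrow> bicomplex \<times> bicomplex"
  where "sym_coeffs n c d =
    [(of_real c, of_real d),
     (- of_real c, - of_real d),
     (- of_real d * bc_i2, of_real c * bc_i2),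
     (of_real d * bc_i2, - of_real c * bc_i2),
     (of_real d * bc_i1, - of_real c * bc_i1),
     (- of_real d * bc_i1, of_real c * bc_i1),
     (of_real c * bc_j, of_real d * bc_j),
     (- of_real c * bc_j, - of_real d * bc_j)] ! n"

text \<open>The symmetry is applied to the exponent \<open>(\<alpha>, \<beta>, \<gamma>, \<delta>)\<close> and not to the function
  \<open>\<psi>\<close>, which does not determine \<open>\<beta>\<close> and \<open>\<gamma>\<close>: the exponential is not injective.\<close>

definition discrete_sym ::
    "nat \<Rightarrow> ('p \<Rightarrow> real) \<Rightarrow> ('p \<Rightarrow> real) \<Rightarrow> ('p \<Rightarrow> real) \<Rightarrow> ('p \<Rightarrow> real) \<Rightarrow> 'p \<Rightarrow> bicomplex"
  where "discrete_sym n \<alpha> \<beta> \<gamma> \<delta> p =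
    (case sym_coeffs n (\<gamma> p) (\<delta> p) of (g, d) \<Rightarrow>
      exp (of_real (\<alpha> p) + of_real (\<beta> p) * bc_i1 + g * bc_i2 + d * bc_j))"

end

(* The two ring homomorphisms phi1, phi2 onto the complex numbers, which give the idempotent
   components of w with respect to (1 + j)/2 and (1 - j)/2, commute with the exponential.
   All three moduli are functions of |phi1 w| and |phi2 w|, and for the exponential of
   a + b i1 + c i2 + d j these are exp (a + d) and exp (a - d). Hence the squared moduli are
   exp (2a), exp (2a) and exp (2a) cosh (2d). The symmetry n = 2 turns the exponent into
   a + d + (b - c) i1, so that already k = 1 forces d = 0; if d = 0, then every symmetry keeps a
   and produces no j-component. *)

theory Submission
  imports Defs
begin

text \<open>Multiplicativity sends powers to powers, and a bounded linear map passes through the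
  convergent exponential series.\<close>

lemma exp_hom:
  fixes f :: "'a::{real_normed_algebra_1,banach} \<Rightarrow> 'b::{real_normed_algebra_1,banach}"
  assumes "bounded_linear f" and one: "f 1 = 1" and mult: "\<And>x y. f (x * y) = f x * f y"
  shows "f (exp x) = exp (f x)"
proof -
  interpret bounded_linear f by fact
  have "f (x ^ n) = f x ^ n" for n
    by (induction n) (simp_all add: one mult)
  moreover have "(\<lambda>n. f (x ^ n /\<^sub>R fact n)) sums f (exp x)"
    by (intro sums exp_converges)
  ultimately have "(\<lambda>n. f x ^ n /\<^sub>R fact n) sums f (exp x)"
    by (simp add: scaleR)
  with exp_converges show ?thesis
    by (rule sums_unique2 [symmetric])
qed

text \<open>This is z1 - i z2 for w = z1 + z2 i2: it maps \<open>bc_i1\<close> to i,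
  \<open>bc_i2\<close> to -i and \<open>bc_j\<close> to 1. In \<open>phi2\<close> the last two signs
  flip.\<close>

definition phi1 :: "bicomplex \<Rightarrow> complex"
  where "phi1 w = Complex (bc0 w + bc3 w) (bc1 w - bc2 w)"

definition phi2 :: "bicomplex \<Rightarrow> complex"
  where "phi2 w = Complex (bc0 w - bc3 w) (bc1 w + bc2 w)"

lemma phi_mult: "phi1 (v * w) = phi1 v * phi1 w" "phi2 (v * w) = phi2 v * phi2 w"
  by (simp_all add: phi1_def phi2_def complex_eq_iff times_bicomplex_def algebra_simps)

lemma phi_one: "phi1 1 = 1" "phi2 1 = 1"
  by (simp_all add: phi1_def phi2_def complex_eq_iff one_bicomplex_def)

lemma bounded_linear_phi: "bounded_linear phi1" "bounded_linear phi2"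
proof -
  \<comment> \<open>The constant 1 suffices because \<open>norm\<close> sums the absolute
    coordinates, which bounds |Re| + |Im|.\<close>
  have "cmod (phi1 w) \<le> norm w * 1" "cmod (phi2 w) \<le> norm w * 1" for w
    using cmod_le [of "phi1 w"] cmod_le [of "phi2 w"]
    by (simp_all add: phi1_def phi2_def norm_bicomplex_def)
  moreover have "linear phi1" "linear phi2"
    by (auto intro!: linearI simp: phi1_def phi2_def complex_eq_iff plus_bicomplex_def
        scaleR_bicomplex_def algebra_simps)
  ultimately show "bounded_linear phi1" "bounded_linear phi2"
    by (blast intro: bounded_linear.intro bounded_linear_axioms.intro)+
qed

lemma cmod_phi_exp:
  "cmod (phi1 (exp w)) = exp (bc0 w + bc3 w)" "cmod (phi2 (exp w)) = exp (bc0 w - bc3 w)"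
  by (simp_all add: exp_hom bounded_linear_phi phi_one phi_mult)
    (simp_all add: phi1_def phi2_def)

text \<open>The factorization is (z1 - i z2)(z1 + i z2).\<close>

lemma bc_mod1_phi: "(bc_mod1 w)\<^sup>2 = cmod (phi1 w) * cmod (phi2 w)"
proof -
  have "(bc_z1 w)\<^sup>2 + (bc_z2 w)\<^sup>2 = phi1 w * phi2 w"
    by (simp add: bc_z1_def bc_z2_def phi1_def phi2_def complex_eq_iff power2_eq_square
        algebra_simps)
  then show ?thesis
    by (simp add: bc_mod1_def norm_mult)
qed

text \<open>The same factorization for u1, u2: u1 - i u2 is the conjugate of \<open>phi1 w\<close>,
  with the same modulus, and u1 + i u2 is \<open>phi2 w\<close>.\<close>

lemma bc_mod2_phi: "(bc_mod2 w)\<^sup>2 = cmod (phi1 w) * cmod (phi2 w)"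
proof -
  have "(bc_u1 w)\<^sup>2 + (bc_u2 w)\<^sup>2 = cnj (phi1 w) * phi2 w"
    by (simp add: bc_u1_def bc_u2_def phi1_def phi2_def complex_eq_iff power2_eq_square
        algebra_simps)
  then show ?thesis
    by (simp add: bc_mod2_def norm_mult)
qed

text \<open>Parallelogram law for z1 and i z2.\<close>

lemma bc_mod3_phi: "(bc_mod3 w)\<^sup>2 = ((cmod (phi1 w))\<^sup>2 + (cmod (phi2 w))\<^sup>2) / 2"
  by (simp add: bc_mod3_def bc_z1_def bc_z2_def phi1_def phi2_def cmod_power2)
    (simp add: power2_eq_square algebra_simps)

lemma bc_mod12_exp:
  "(bc_mod1 (exp w))\<^sup>2 = exp (2 * bc0 w)" "(bc_mod2 (exp w))\<^sup>2 = exp (2 * bc0 w)"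
  by (simp_all add: bc_mod1_phi bc_mod2_phi cmod_phi_exp flip: exp_add)

lemma bc_mod_exp:
  assumes "bc3 w = 0"
  shows "(bc_mod k (exp w))\<^sup>2 = exp (2 * bc0 w)"
  using assms by (simp add: bc_mod_def bc_mod12_exp bc_mod3_phi cmod_phi_exp exp_double)

text \<open>With zero j-component the symmetries keep \<open>\<alpha>\<close> and may only change
  \<open>\<beta>\<close> and \<open>\<gamma>\<close>, which no modulus sees.\<close>

lemma discrete_sym_born:
  assumes "\<delta> p = 0" "n \<le> 7"
  shows "(bc_mod k (discrete_sym n \<alpha> \<beta> \<gamma> \<delta> p))\<^sup>2 = exp (2 * \<alpha> p)"
proof -
  obtain g d where gd: "sym_coeffs n (\<gamma> p) (\<delta> p) = (g, d)"
    by fastforce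
  let ?w = "of_real (\<alpha> p) + of_real (\<beta> p) * bc_i1 + g * bc_i2 + d * bc_j"
  have "n \<in> {0, 1, 2, 3, 4, 5, 6, 7}"
    using assms(2) by auto
  then have "bc0 ?w = \<alpha> p \<and> bc3 ?w = 0"
    using gd assms(1)
    by (auto simp: sym_coeffs_def of_real_def bc_i1_def bc_i2_def bc_j_def bc_ring_defs)
  then show ?thesis
    using bc_mod_exp [of ?w k] by (simp add: discrete_sym_def gd)
qed

text \<open>Since -\<delta> i2 i2 = \<delta> and \<gamma> i2 j = -\<gamma> i1, \<delta> moves into
  the real part.\<close>

lemma discrete_sym_2:
  "discrete_sym 2 \<alpha> \<beta> \<gamma> \<delta> p = exp (Bicomplex (\<alpha> p + \<delta> p) (\<beta> p - \<gamma> p) 0 0)"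
  by (simp add: discrete_sym_def sym_coeffs_def of_real_def bc_i1_def bc_i2_def bc_j_def
      bc_ring_defs)

text \<open>The moduli of the two components determine \<open>bc0 + bc3\<close> and
  \<open>bc0 - bc3\<close>, hence \<open>bc3\<close>, although \<open>exp\<close> is not injective
  here.\<close>

lemma exp_eq_imp_bc3_eq:
  assumes "exp v = exp w"
  shows "bc3 v = bc3 w"
  using cmod_phi_exp [of v] cmod_phi_exp [of w] by (simp_all add: assms)

theorem mainTheorem4:
  fixes \<alpha> \<beta> \<gamma> \<delta> :: "real \<times> real \<Rightarrow> real"
    and \<psi> :: "real \<times> real \<Rightarrow> bicomplex"
  assumes psi: "\<And>x t. \<psi> (x, t) = exp (of_real (\<alpha> (x, t)) + of_real (\<beta> (x, t)) * bc_i1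
      + of_real (\<gamma> (x, t)) * bc_i2 + of_real (\<delta> (x, t)) * bc_j)"
  shows "((\<forall>n\<in>{0..7}. \<forall>k\<in>{1, 2, 3}. \<forall>x t.
            (bc_mod k (discrete_sym n \<alpha> \<beta> \<gamma> \<delta> (x, t)))\<^sup>2 = (bc_mod k (\<psi> (x, t)))\<^sup>2)
          \<longleftrightarrow> (\<forall>x t. \<psi> (x, t) = exp (of_real (\<alpha> (x, t)) + of_real (\<beta> (x, t)) * bc_i1
                              + of_real (\<gamma> (x, t)) * bc_i2)))
       \<and> ((\<forall>x t. \<psi> (x, t) = exp (of_real (\<alpha> (x, t)) + of_real (\<beta> (x, t)) * bc_i1
                              + of_real (\<gamma> (x, t)) * bc_i2))
          \<longleftrightarrow> (\<forall>x t. \<delta> (x, t) = 0))"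
    (is "(?born \<longleftrightarrow> ?form) \<and> (?form \<longleftrightarrow> ?zero)")
proof -
  have psi': "\<psi> p = exp (Bicomplex (\<alpha> p) (\<beta> p) (\<gamma> p) (\<delta> p))" for p
    by (cases p) (simp add: psi bicomplex_expand)
  have form: "?form \<longleftrightarrow> ?zero"
  proof
    assume ?form
    then have "exp (Bicomplex (\<alpha> (x, t)) (\<beta> (x, t)) (\<gamma> (x, t)) (\<delta> (x, t)))
        = exp (Bicomplex (\<alpha> (x, t)) (\<beta> (x, t)) (\<gamma> (x, t)) 0)" for x t
      by (simp add: bicomplex_expand psi)
    then show ?zero
      using exp_eq_imp_bc3_eq by fastforce
  qed (simp add: psi)
  have born: "?born \<longleftrightarrow> ?zero"
  proof
    assume ?born
    then have "(bc_mod 1 (discrete_sym 2 \<alpha> \<beta> \<gamma> \<delta> (x, t)))\<^sup>2 = (bc_mod 1 (\<psi> (x, t)))\<^sup>2" for x t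
      by simp
    \<comment> \<open>The equation reads exp (2 (\<alpha> + \<delta>)) = exp (2 \<alpha>), and the
      real exponential is injective.\<close>
    then show ?zero
      by (simp add: bc_mod_def discrete_sym_2 psi' bc_mod12_exp)
  next
    assume ?zero
    then show ?born
      by (simp add: discrete_sym_born psi' bc_mod_exp)
  qed
  from born form show ?thesis
    by blast
qed

end
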